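(* Let $C_n$ be the cycle on $n\ge 3$ vertices and $k$ a positive integer with $k\ge\chi(C_n)$ and $n\ge k+1$. Then the strong $k$-colour graph $S_k(C_n)$ is connected if and only if $k\ge 4$, $n\ge 6$ and $n\ge k+1$.
   Context: A proper $k$-colouring of a graph $G$ is a map $V(G)\to\{1,\dots,k\}$ giving adjacent vertices different colours; it is strong if all $k$ colours appear. The strong $k$-colour graph $S_k(G)$ has the strong $k$-colourings of $G$ as vertices, two being adjacent iff they differ in colour on exactly one vertex of $G$. *)

theory Defs
  imports
    "Graph_Theory.Pair_Digraph"
    "Graph_Theory.Digraph_Component"
    "HOL-Library.FuncSet"
begin

text \<open>
  A simple graph is represented as a \<^typ>\<open>'a pair_pre_digraph\<close> satisfying \<^const>\<open>pair_graph\<close>: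
  an edge \<open>{u, v}\<close> is the pair of arcs \<open>(u, v)\<close>, \<open>(v, u)\<close>.
\<close>

definition cycle_graph :: "nat \<Rightarrow> nat pair_pre_digraph" where
  "cycle_graph n =
     \<lparr> pverts = {..<n},
       parcs = {(i, j). i < n \<and> j < n \<and> (j = Suc i mod n \<or> i = Suc j mod n)} \<rparr>"

text \<open>
  Colourings are extensional functions (value \<^const>\<open>undefined\<close> outside the vertex set), so that
  two colourings are equal iff they agree on all vertices.
\<close>

definition proper_colourings :: "'a pair_pre_digraph \<Rightarrow> nat \<Rightarrow> ('a \<Rightarrow> nat) set" where
  "proper_colourings G k =
     {c \<in> pverts G \<rightarrow>\<^sub>E {1..k}. \<forall>(u, v) \<in> parcs G. c u \<noteq> c v}"

text \<open>Only meaningful for graphs having some proper colouring, in particular finite simple graphs.\<close>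

definition chromatic_number :: "'a pair_pre_digraph \<Rightarrow> nat" where
  "chromatic_number G = (LEAST k. proper_colourings G k \<noteq> {})"

definition strong_colourings :: "'a pair_pre_digraph \<Rightarrow> nat \<Rightarrow> ('a \<Rightarrow> nat) set" where
  "strong_colourings G k = {c \<in> proper_colourings G k. c ` pverts G = {1..k}}"

definition strong_colour_graph ::
    "'a pair_pre_digraph \<Rightarrow> nat \<Rightarrow> ('a \<Rightarrow> nat) pair_pre_digraph" where
  "strong_colour_graph G k =
     \<lparr> pverts = strong_colourings G k,
       parcs = {(c, d). c \<in> strong_colourings G k \<and> d \<in> strong_colourings G k \<and>
                        (\<exists>!v. v \<in> pverts G \<and> c v \<noteq> d v)} \<rparr>"

lemma pair_graph_cycle_graph:
  assumes "n \<ge> 3"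
  shows "pair_graph (cycle_graph n)"
proof
  show "finite (parcs (cycle_graph n))"
    by (rule finite_subset[of _ "{..<n} \<times> {..<n}"]) (auto simp: cycle_graph_def)
  show "symmetric (with_proj (cycle_graph n))"
    by (auto simp: symmetric_def sym_def cycle_graph_def)
  fix e assume "e \<in> parcs (cycle_graph n)"
  with assms show "fst e \<noteq> snd e"
    by (cases "Suc (fst e) = n") (auto simp: cycle_graph_def)
qed (auto simp: cycle_graph_def)

lemma pair_graph_strong_colour_graph:
  assumes "finite (pverts G)"
  shows "pair_graph (strong_colour_graph G k)"
proof
  have fin: "finite (strong_colourings G k)"
    by (rule finite_subset[OF _ finite_PiE[OF assms, of "\<lambda>_. {1..k}"]])
       (auto simp: strong_colourings_def proper_colourings_def)
  then show "finite (pverts (strong_colour_graph G k))"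
    by (simp add: strong_colour_graph_def)
  show "finite (parcs (strong_colour_graph G k))"
    by (rule finite_subset[OF _ finite_cartesian_product[OF fin fin]])
       (auto simp: strong_colour_graph_def)
  show "symmetric (with_proj (strong_colour_graph G k))"
    by (auto simp: symmetric_def sym_def strong_colour_graph_def)
qed (auto simp: strong_colour_graph_def)

end

theory Submission
  imports Defs
begin

text \<open>
  A recolouring of a single vertex either preserves an invariant (small cases) or can be used to
  reduce to a shorter cycle. Invariants: for \<open>k \<le> 2\<close> and for \<open>(n, k) = (4, 3)\<close> no move exists at all;
  for \<open>k = 3\<close> the winding number of the colouring around the triangle is preserved, and mirroring the
  colours negates it; for \<open>(n, k) = (5, 4)\<close> the complement of the cycle is again a 5-cycle, and the
  cyclic order in which the four colours occur along it is preserved.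

  For \<open>k \<ge> 4\<close> and \<open>n \<ge> 6\<close> one inducts on \<open>n\<close>. If \<open>n \<ge> k + 2\<close>, any colouring can be moved
  to one whose last vertex can be deleted, giving a strong \<open>k\<close>-colouring of the shorter cycle; four
  colours are enough to move the deleted vertex out of the way when a recolouring of the shorter cycle
  is lifted. If \<open>n = k + 1\<close>, the colouring is a sliding puzzle on the complement of the cycle with
  a single hole, and the colour \<open>k\<close> can be slid to the last vertex and deleted together with it. Both
  reductions end at the 5-cycle with 4 colours, where the cyclic order is the only invariant; with
  the sixth vertex present the hole can go once round a triangle of the complement, which transposes
  two colours.
\<close>

section \<open>Recolouring moves\<close>

abbreviation SC :: "nat \<Rightarrow> nat \<Rightarrow> (nat \<Rightarrow> nat) set" where
  "SC n k \<equiv> strong_colourings (cycle_graph n) k"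

definition adj :: "nat \<Rightarrow> nat \<Rightarrow> nat \<Rightarrow> bool" where
  "adj n i j \<longleftrightarrow> Suc i = j \<or> Suc j = i \<or> i = 0 \<and> Suc j = n \<or> j = 0 \<and> Suc i = n"

definition recol :: "nat \<Rightarrow> nat \<Rightarrow> (nat \<Rightarrow> nat) \<Rightarrow> (nat \<Rightarrow> nat) \<Rightarrow> bool" where
  "recol n k c d \<longleftrightarrow> c \<in> SC n k \<and> d \<in> SC n k \<and> (\<exists>v<n. \<forall>u. u \<noteq> v \<longrightarrow> d u = c u)"

abbreviation reach :: "nat \<Rightarrow> nat \<Rightarrow> (nat \<Rightarrow> nat) \<Rightarrow> (nat \<Rightarrow> nat) \<Rightarrow> bool" where
  "reach n k \<equiv> (recol n k)\<^sup>*\<^sup>*"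

lemma adj_sym: "adj n i j \<longleftrightarrow> adj n j i"
  by (auto simp: adj_def)

lemma pverts_cycle_graph: "pverts (cycle_graph n) = {..<n}"
  by (simp add: cycle_graph_def)

lemma SC_iff:
  assumes "n \<ge> 3"
  shows "c \<in> SC n k \<longleftrightarrow> c \<in> extensional {..<n} \<and> c ` {..<n} = {1..k} \<and>
           (\<forall>i<n. \<forall>j<n. adj n i j \<longrightarrow> c i \<noteq> c j)"
proof -
  have arcs: "(i, j) \<in> parcs (cycle_graph n) \<longleftrightarrow> i < n \<and> j < n \<and> adj n i j" for i j
  proof (cases "i < n \<and> j < n")
    case True
    then have "Suc i mod n = (if Suc i = n then 0 else Suc i)"
      and "Suc j mod n = (if Suc j = n then 0 else Suc j)" by auto
    with True assms show ?thesis by (auto simp: cycle_graph_def adj_def)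
  qed (auto simp: cycle_graph_def)
  show ?thesis
    unfolding strong_colourings_def proper_colourings_def
    by (auto simp: arcs pverts_cycle_graph PiE_def Pi_def)
qed

text \<open>The vertex \<open>w\<close> keeps the old colour of \<open>v\<close> in use, so the new
  colouring is still strong.\<close>

lemma SC_recol:
  assumes "n \<ge> 3" "c \<in> SC n k" "v < n" "w < n" "w \<noteq> v" "c w = c v" "x \<in> {1..k}"
    and nb: "\<And>u. u < n \<Longrightarrow> adj n u v \<Longrightarrow> c u \<noteq> x"
  shows "c(v := x) \<in> SC n k" and "reach n k c (c(v := x))"
proof -
  have c: "c \<in> extensional {..<n}" "c ` {..<n} = {1..k}"
    "\<And>i j. i < n \<Longrightarrow> j < n \<Longrightarrow> adj n i j \<Longrightarrow> c i \<noteq> c j"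
    using assms by (auto simp: SC_iff)
  have "y \<in> c(v := x) ` {..<n}" if y: "y \<in> {1..k}" for y
  proof -
    obtain i where i: "i < n" "c i = y" using y c(2) by (metis imageE lessThan_iff)
    show ?thesis
    proof (cases "i = v")
      case True
      then have "(c(v := x)) w = y" using i assms by simp
      then show ?thesis using assms(4) by blast
    next
      case False
      then have "(c(v := x)) i = y" using i by simp
      then show ?thesis using i by blast
    qed
  qed
  moreover have "(c(v := x)) i \<in> {1..k}" if "i < n" for i
    using that c(2) assms(7) by auto
  ultimately have im: "c(v := x) ` {..<n} = {1..k}" by blast
  have irr: "\<not> adj n v v" using assms(1) by (auto simp: adj_def)
  have "(c(v := x)) i \<noteq> (c(v := x)) j" if ij: "i < n" "j < n" "adj n i j" for i j
    using c(3)[OF ij] nb[of i] nb[of j] ij irr adj_sym[of n i j] by auto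
  with im c(1) assms(1,3) show *: "c(v := x) \<in> SC n k"
    by (auto simp: SC_iff extensional_def)
  show "reach n k c (c(v := x))"
    using * assms(2,3) unfolding recol_def[abs_def] by (intro r_into_rtranclp) auto
qed

lemma reach_sym: "reach n k c d \<Longrightarrow> reach n k d c"
proof -
  have "symp (recol n k)" by (auto simp: symp_def recol_def)
  then show "reach n k c d \<Longrightarrow> reach n k d c" by (metis symp_rtranclp sympD)
qed

lemma reach_SC: "reach n k c d \<Longrightarrow> c \<in> SC n k \<Longrightarrow> d \<in> SC n k"
  by (induction rule: rtranclp_induct) (auto simp: recol_def)

text \<open>Connectedness of a digraph includes having a vertex, hence the first conjunct. The arcs
  are exactly the nontrivial moves of \<open>recol\<close>.\<close>

lemma connected_iff_reach:
  "Digraph_Component.connected (with_proj (strong_colour_graph (cycle_graph n) k)) \<longleftrightarrow>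
    SC n k \<noteq> {} \<and> (\<forall>c\<in>SC n k. \<forall>d\<in>SC n k. reach n k c d)"
proof -
  let ?G = "strong_colour_graph (cycle_graph n) k"
  have verts: "pverts ?G = SC n k" by (simp add: strong_colour_graph_def)
  have ext: "c u = d u" if "c \<in> SC n k" "d \<in> SC n k" "\<not> u < n" for c d u
    using that by (auto simp: strong_colourings_def proper_colourings_def cycle_graph_def PiE_def
      extensional_def)
  have arcs: "(c, d) \<in> (parcs ?G)\<^sup>s \<longleftrightarrow> recol n k c d \<and> c \<noteq> d" for c d
  proof -
    have uniq: "(\<exists>!v. v < n \<and> c v \<noteq> d v) \<longleftrightarrow> (\<exists>v<n. \<forall>u. u \<noteq> v \<longrightarrow> d u = c u) \<and> c \<noteq> d"
      if "c \<in> SC n k" "d \<in> SC n k"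
    proof
      assume "\<exists>!v. v < n \<and> c v \<noteq> d v"
      then obtain v where "v < n" "c v \<noteq> d v" "\<And>u. u < n \<Longrightarrow> u \<noteq> v \<Longrightarrow> d u = c u" by metis
      with ext[OF that] show "(\<exists>v<n. \<forall>u. u \<noteq> v \<longrightarrow> d u = c u) \<and> c \<noteq> d" by metis
    next
      assume "(\<exists>v<n. \<forall>u. u \<noteq> v \<longrightarrow> d u = c u) \<and> c \<noteq> d"
      then obtain v where v: "v < n" "\<And>u. u \<noteq> v \<Longrightarrow> d u = c u" and "c \<noteq> d" by blast
      then have "c v \<noteq> d v" by force
      with v show "\<exists>!v. v < n \<and> c v \<noteq> d v" by (metis (full_types))
    qed
    have parcs: "(c, d) \<in> parcs ?G \<longleftrightarrow>
        c \<in> SC n k \<and> d \<in> SC n k \<and> (\<exists>!v. v < n \<and> c v \<noteq> d v)" for c d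
      by (simp add: strong_colour_graph_def pverts_cycle_graph)
    have "(c, d) \<in> (parcs ?G)\<^sup>s \<longleftrightarrow> (c, d) \<in> parcs ?G \<or> (d, c) \<in> parcs ?G"
      by (auto simp: symcl_def)
    moreover have "(c, d) \<in> parcs ?G \<longleftrightarrow> (d, c) \<in> parcs ?G"
      unfolding parcs by (simp only: eq_commute[of "c _" "d _"] conj_ac)
    ultimately have "(c, d) \<in> (parcs ?G)\<^sup>s \<longleftrightarrow> (c, d) \<in> parcs ?G"
      by (simp only: disj_absorb)
    also have "\<dots> \<longleftrightarrow> recol n k c d \<and> c \<noteq> d"
    proof (cases "c \<in> SC n k \<and> d \<in> SC n k")
      case True
      then show ?thesis by (simp only: parcs recol_def uniq simp_thms)
    next
      case False
      then have "(c, d) \<notin> parcs ?G" "\<not> recol n k c d" unfolding parcs recol_def by argo+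
      then show ?thesis by simp
    qed
    finally show ?thesis .
  qed
  have "(c, d) \<in> rtrancl_on (SC n k) ((parcs ?G)\<^sup>s) \<longleftrightarrow> reach n k c d"
    if "c \<in> SC n k" for c d
  proof
    show "reach n k c d" if "(c, d) \<in> rtrancl_on (SC n k) ((parcs ?G)\<^sup>s)"
      using that by (induction rule: rtrancl_on_induct) (auto simp: arcs)
    show "(c, d) \<in> rtrancl_on (SC n k) ((parcs ?G)\<^sup>s)" if "reach n k c d"
      using that
    proof (induction rule: rtranclp_induct)
      case (step d e)
      show ?case
      proof (cases "d = e")
        case False
        with step have "(d, e) \<in> (parcs ?G)\<^sup>s" "e \<in> SC n k" by (auto simp: arcs recol_def)
        with step show ?thesis by (blast intro: rtrancl_on_into_rtrancl_on)
      qed (use step in simp)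
    qed (use \<open>c \<in> SC n k\<close> in simp)
  qed
  then show ?thesis by (simp add: connected_conv verts)
qed

lemma not_connected_by_invariant:
  assumes "\<And>c d. recol n k c d \<Longrightarrow> W c = W d" "c \<in> SC n k" "d \<in> SC n k" "W c \<noteq> W d"
  shows "\<not> Digraph_Component.connected (with_proj (strong_colour_graph (cycle_graph n) k))"
proof -
  have "W c = W e" if "reach n k c e" for e
    using that by (induction rule: rtranclp_induct) (use assms(1) in auto)
  with assms show ?thesis by (auto simp: connected_iff_reach)
qed

section \<open>Disconnected cases\<close>

definition turn :: "nat \<Rightarrow> nat \<Rightarrow> int" where
  "turn a b = (if b mod 3 = Suc a mod 3 then 1 else -1)"

text \<open>Colours count as residues modulo 3. On a proper 3-colouring the sum is three times the
  usual winding number of a closed walk on the triangle.\<close>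

definition winding :: "nat \<Rightarrow> (nat \<Rightarrow> nat) \<Rightarrow> int" where
  "winding n c = (\<Sum>i<n. turn (c i) (c (Suc i mod n)))"

lemma turn_reverse:
  assumes "a \<in> {1..3}" "b \<in> {1..3}" "a \<noteq> b"
  shows "turn b a = - turn a b" and "turn (4 - a) (4 - b) = - turn a b"
proof -
  have "a \<in> {1, 2, 3}" "b \<in> {1, 2, 3}" using assms by auto
  with assms(3) show "turn b a = - turn a b" "turn (4 - a) (4 - b) = - turn a b"
    by (auto simp: turn_def)
qed

lemma adj_Suc_mod: "n \<ge> 3 \<Longrightarrow> i < n \<Longrightarrow> adj n i (Suc i mod n)"
  by (cases "Suc i = n") (auto simp: adj_def)

lemma SC_range: "n \<ge> 3 \<Longrightarrow> c \<in> SC n k \<Longrightarrow> i < n \<Longrightarrow> c i \<in> {1..k}"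
  by (auto simp: SC_iff)

lemma SC_adj: "n \<ge> 3 \<Longrightarrow> c \<in> SC n k \<Longrightarrow> i < n \<Longrightarrow> j < n \<Longrightarrow> adj n i j \<Longrightarrow> c i \<noteq> c j"
  by (auto simp: SC_iff)

lemma SC_mirror:
  assumes n: "n \<ge> 3" and c: "c \<in> SC n k"
  shows "(\<lambda>i\<in>{..<n}. Suc k - c i) \<in> SC n k"
proof -
  have "(\<lambda>i\<in>{..<n}. Suc k - c i) ` {..<n} = (\<lambda>x. Suc k - x) ` c ` {..<n}" by auto
  also have "c ` {..<n} = {1..k}" using n c by (simp add: SC_iff)
  also have "(\<lambda>x. Suc k - x) ` {1..k} = {1..k}"
  proof
    show "{1..k} \<subseteq> (\<lambda>x. Suc k - x) ` {1..k}"
    proof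
      fix x assume "x \<in> {1..k}"
      then have "x = Suc k - (Suc k - x)" "Suc k - x \<in> {1..k}" by auto
      then show "x \<in> (\<lambda>x. Suc k - x) ` {1..k}" by (rule image_eqI)
    qed
  qed auto
  finally have im: "(\<lambda>i\<in>{..<n}. Suc k - c i) ` {..<n} = {1..k}" .
  have "Suc k - c i \<noteq> Suc k - c j" if ij: "i < n" "j < n" "adj n i j" for i j
    using SC_adj[OF n c ij] SC_range[OF n c ij(1)] SC_range[OF n c ij(2)] by auto
  with n im show ?thesis by (simp add: SC_iff)
qed

text \<open>A vertex can change its colour only if its two neighbours agree. Before and after the
  move the walk then goes out and straight back there, contributing 0.\<close>

lemma winding_invariant:
  assumes n: "n \<ge> 3" and "recol n 3 c d"
  shows "winding n c = winding n d"
proof -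
  from assms obtain v where cd: "c \<in> SC n 3" "d \<in> SC n 3"
    and v: "v < n" and same: "\<And>u. u \<noteq> v \<Longrightarrow> d u = c u"
    by (auto simp: recol_def)
  show ?thesis
  proof (cases "d v = c v")
    case True
    then have "d = c" using same by (metis ext)
    then show ?thesis by simp
  next
    case False
    define u where "u = (if v = 0 then n - 1 else v - 1)"
    define w where "w = Suc v mod n"
    have u: "u < n" "Suc u mod n = v" "u \<noteq> v" using n v by (auto simp: u_def)
    have w: "w < n" "w \<noteq> v" using n v by (auto simp: w_def mod_Suc)
    have au: "adj n u v" using adj_Suc_mod[OF n u(1)] u(2) by simp
    have aw: "adj n v w" using adj_Suc_mod[OF n v] by (simp add: w_def)
    have r: "c u \<in> {1..3}" "c v \<in> {1..3}" "c w \<in> {1..3}" "d v \<in> {1..3}"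
      using SC_range[OF n] cd u(1) v w(1) by blast+
    have ne: "c u \<noteq> c v" "c u \<noteq> d v" "c v \<noteq> c w" "d v \<noteq> c w"
      using SC_adj[OF n cd(1) u(1) v au] SC_adj[OF n cd(2) u(1) v au]
        SC_adj[OF n cd(1) v w(1) aw] SC_adj[OF n cd(2) v w(1) aw] same u(3) w(2) by auto
    \<comment> \<open>Both neighbours avoid the two different colours \<open>c v\<close> and
      \<open>d v\<close>, which leaves one colour of three.\<close>
    have cw: "c w = c u" using r ne False by simp
    have split: "winding n e = turn (e u) (e v) + turn (e v) (e w) +
        (\<Sum>i\<in>{..<n} - {u, v}. turn (e i) (e (Suc i mod n)))" for e
    proof -
      have "winding n e = turn (e u) (e (Suc u mod n)) +
          (\<Sum>i\<in>{..<n} - {u}. turn (e i) (e (Suc i mod n)))"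
        unfolding winding_def by (rule sum.remove) (use u in auto)
      also have "(\<Sum>i\<in>{..<n} - {u}. turn (e i) (e (Suc i mod n))) = turn (e v) (e (Suc v mod n)) +
          (\<Sum>i\<in>{..<n} - {u} - {v}. turn (e i) (e (Suc i mod n)))"
        by (rule sum.remove) (use u v in auto)
      also have "{..<n} - {u} - {v} = {..<n} - {u, v}" by auto
      finally show ?thesis using u(2) by (simp add: w_def)
    qed
    have "Suc i mod n \<noteq> v" if "i < n" "i \<noteq> u" for i
      using that u(1,2) by (auto simp: mod_Suc split: if_splits)
    then have rest: "(\<Sum>i\<in>{..<n} - {u, v}. turn (d i) (d (Suc i mod n))) =
        (\<Sum>i\<in>{..<n} - {u, v}. turn (c i) (c (Suc i mod n)))"
      by (intro sum.cong) (auto simp: same)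
    have "turn (c u) (c v) + turn (c v) (c w) = 0" "turn (d u) (d v) + turn (d v) (d w) = 0"
      using turn_reverse(1)[of "c u" "c v"] turn_reverse(1)[of "c u" "d v"] r ne cw same u(3) w(2)
      by auto
    then show ?thesis unfolding split[of c] split[of d] rest by simp
  qed
qed

text \<open>A colouring with nonzero winding and its mirror image lie in different components. The
  full turns take up \<open>m\<close> vertices with \<open>m\<close> of the parity of
  \<open>n\<close>; only \<open>n = 4\<close> is too short for that.\<close>

lemma not_connected_3:
  assumes n: "n \<ge> 3" and n4: "n \<noteq> 4"
  shows "\<not> Digraph_Component.connected (with_proj (strong_colour_graph (cycle_graph n) 3))"
proof -
  \<comment> \<open>one or two full turns, then a zigzag of even length that contributes nothing\<close>
  define m :: nat where "m = (if even n then 6 else 3)"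
  define b where "b i = (if i < m then Suc (i mod 3) else Suc ((i - m) mod 2))" for i
  define c where "c = restrict b {..<n}"
  have m: "m = 3 \<or> m = 6" by (auto simp: m_def)
  have nm: "m \<le> n" using n n4 by (cases "even n"; cases "n = 5") (auto simp: m_def elim!: evenE)
  have "even (n - m)" using nm by (auto simp: m_def)
  then obtain j where j: "n = m + 2 * j" using nm by (metis evenE le_add_diff_inverse)
  have range: "b i \<in> {1..3}" for i by (auto simp: b_def)
  have bm: "b (m + i) = Suc (i mod 2)" for i by (simp add: b_def)
  \<comment> \<open>The pattern closes up: position \<open>n\<close> has even offset in the zigzag
    and would again get colour 1.\<close>
  have bn: "b n = b 0" using j m by (auto simp: b_def)
  have neq: "b i \<noteq> b (Suc i)" for i
  proof (cases "Suc i < m")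
    case True
    then show ?thesis using m by (auto simp: b_def mod_Suc)
  next
    case False
    show ?thesis
    proof (cases "Suc i = m")
      case True
      then have "i = 2 \<or> i = 5" using m by auto
      then show ?thesis using m True by (auto simp: b_def)
    next
      case neq: False
      with False obtain l where "i = m + l" by (metis less_SucE not_less_eq nat_le_iff_add not_less)
      then show ?thesis using bm[of l] bm[of "Suc l"] by (simp add: mod_Suc)
    qed
  qed
  have cb: "c i = b i" if "i < n" for i using that by (simp add: c_def)
  have cs: "c (Suc i mod n) = b (Suc i)" if "i < n" for i
    using that n bn cb by (cases "Suc i = n") auto
  have proper: "c i \<noteq> c j" if ij: "i < n" "j < n" "adj n i j" for i j
  proof -
    have "j = Suc i mod n \<or> i = Suc j mod n" using ij n by (auto simp: adj_def)
    then show ?thesis using cs[of i] cs[of j] cb[of i] cb[of j] neq[of i] neq[of j] ij by auto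
  qed
  have "{1..3} \<subseteq> c ` {..<n}"
  proof
    fix x :: nat assume "x \<in> {1..3}"
    then have "c (x - 1) = x" "x - 1 < n" using n m cb[of "x - 1"] by (auto simp: b_def)
    then show "x \<in> c ` {..<n}" by (metis imageI lessThan_iff)
  qed
  then have im: "c ` {..<n} = {1..3}" using cb range by auto
  have c: "c \<in> SC n 3" using n im proper by (simp add: SC_iff c_def)
  define d where "d = (\<lambda>i\<in>{..<n}. 4 - c i)"
  have d: "d \<in> SC n 3" using SC_mirror[OF n c] by (simp add: d_def)
  have split: "(\<Sum>i<m + l. f i) = (\<Sum>i<m. f i) + (\<Sum>i<l. f (m + i))" for f :: "nat \<Rightarrow> int" and l
    by (induction l) simp_all
  have "winding n c = (\<Sum>i<n. turn (b i) (b (Suc i)))"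
    unfolding winding_def
  proof (intro sum.cong refl)
    fix i assume "i \<in> {..<n}"
    then have "c i = b i" "c (Suc i mod n) = b (Suc i)" using cb cs by blast+
    then show "turn (c i) (c (Suc i mod n)) = turn (b i) (b (Suc i))" by (simp only:)
  qed
  also have "\<dots> = (\<Sum>i<m. turn (b i) (b (Suc i))) + (\<Sum>i<2 * j. turn (b (m + i)) (b (Suc (m + i))))"
    unfolding j by (rule split)
  also have "(\<Sum>i<2 * j. turn (b (m + i)) (b (Suc (m + i)))) = 0"
  proof (induction j)
    case (Suc j)
    have "turn (b (m + 2 * j)) (b (Suc (m + 2 * j))) = 1"
      using bm[of "2 * j"] bm[of "Suc (2 * j)"] by (simp add: turn_def)
    moreover have "turn (b (Suc (m + 2 * j))) (b (Suc (Suc (m + 2 * j)))) = -1"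
      using bm[of "Suc (2 * j)"] bm[of "Suc (Suc (2 * j))"] by (simp add: turn_def)
    ultimately show ?case using Suc by simp
  qed simp
  also have "(\<Sum>i<m. turn (b i) (b (Suc i))) = int m"
  proof -
    have "turn (b i) (b (Suc i)) = 1" if "i < m" for i
    proof (cases "Suc i < m")
      case True
      then show ?thesis by (simp add: b_def turn_def) (metis mod_Suc_eq)
    next
      case False
      with that m have "i = 2 \<and> m = 3 \<or> i = 5 \<and> m = 6" by auto
      then show ?thesis by (auto simp: b_def turn_def)
    qed
    then show ?thesis by simp
  qed
  finally have "winding n c = int m" by simp
  moreover have "winding n d = - winding n c"
    unfolding winding_def sum_negf[symmetric]
  proof (intro sum.cong refl)
    fix i assume i: "i \<in> {..<n}"
    then have l: "Suc i mod n < n" by auto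
    have "c i \<noteq> c (Suc i mod n)" using proper[OF _ l adj_Suc_mod[OF n]] i by auto
    moreover have "c i \<in> {1..3}" "c (Suc i mod n) \<in> {1..3}"
      using range[of i] range[of "Suc i mod n"] cb[of i] cb[OF l] i by (simp_all only: lessThan_iff)
    ultimately have "turn (4 - c i) (4 - c (Suc i mod n)) = - turn (c i) (c (Suc i mod n))"
      by (intro turn_reverse(2))
    then show "turn (d i) (d (Suc i mod n)) = - turn (c i) (c (Suc i mod n))"
      using i l by (simp add: d_def)
  qed
  ultimately have "winding n c \<noteq> winding n d" using m by auto
  with not_connected_by_invariant[where W = "winding n", OF winding_invariant[OF n] c d]
  show ?thesis by blast
qed

section \<open>Colourings that admit no move at all\<close>

lemma not_connected_frozen:
  assumes "\<And>c d. recol n k c d \<Longrightarrow> c = d" "\<And>c. c \<in> SC n k \<Longrightarrow> \<exists>d\<in>SC n k. d \<noteq> c"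
  shows "\<not> Digraph_Component.connected (with_proj (strong_colour_graph (cycle_graph n) k))"
proof (cases "SC n k = {}")
  \<comment> \<open>A graph without vertices is not connected by definition.\<close>
  case True
  then show ?thesis by (simp add: connected_iff_reach)
next
  case False
  then obtain c d where "c \<in> SC n k" "d \<in> SC n k" "d \<noteq> c" using assms(2) by blast
  with not_connected_by_invariant[where W = id] assms(1) show ?thesis by fastforce
qed

lemma not_connected_le_2:
  assumes n: "n \<ge> 3" and k: "k \<le> 2"
  shows "\<not> Digraph_Component.connected (with_proj (strong_colour_graph (cycle_graph n) k))"
proof (rule not_connected_frozen)
  fix c d assume "recol n k c d"
  then obtain v where cd: "c \<in> SC n k" "d \<in> SC n k"
    and v: "v < n" and same: "\<And>u. u \<noteq> v \<Longrightarrow> d u = c u"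
    by (auto simp: recol_def)
  define w where "w = Suc v mod n"
  have w: "w < n" "w \<noteq> v" using n v by (auto simp: w_def mod_Suc)
  have aw: "adj n v w" using adj_Suc_mod[OF n v] by (simp add: w_def)
  have "c v \<noteq> c w" "d v \<noteq> c w"
    using SC_adj[OF n cd(1) v w(1) aw] SC_adj[OF n cd(2) v w(1) aw] same w(2) by auto
  moreover have "c v \<in> {1..k}" "c w \<in> {1..k}" "d v \<in> {1..k}"
    using SC_range[OF n] cd v w(1) by blast+
  ultimately have "d v = c v" using k by auto
  then show "c = d" using same by (metis ext)
next
  fix c assume c: "c \<in> SC n k"
  have ne: "c 0 \<noteq> c 1" using SC_adj[OF n c, of 0 1] n by (auto simp: adj_def)
  moreover have r01: "c 0 \<in> {1..k}" "c 1 \<in> {1..k}" using SC_range[OF n c] n by auto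
  \<comment> \<open>With fewer than two colours there is no colouring; with exactly two, the mirror
    image swaps them.\<close>
  ultimately have k2: "k = 2" using k by auto
  define d where "d = (\<lambda>i\<in>{..<n}. Suc k - c i)"
  have "d \<in> SC n k" using SC_mirror[OF n c] by (simp add: d_def)
  moreover have "d 0 \<noteq> c 0" using r01 k2 n by (simp add: d_def) arith
  ultimately show "\<exists>d\<in>SC n k. d \<noteq> c" by fastforce
qed

text \<open>The colour that \<open>v\<close> gives up must survive in \<open>d\<close>, so some
  other vertex has it already in \<open>c\<close>, and properness of \<open>c\<close> makes that
  vertex a non-neighbour of \<open>v\<close>.\<close>

lemma recol_witness:
  assumes n: "n \<ge> 3" and c: "c \<in> SC n k" and d: "d \<in> SC n k" and v: "v < n"
    and same: "\<And>u. u \<noteq> v \<Longrightarrow> d u = c u"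
    and ne: "d v \<noteq> c v"
  obtains w where "w < n" "w \<noteq> v" "\<not> adj n w v" "c w = c v"
proof -
  have "c v \<in> d ` {..<n}" using SC_range[OF n c v] d n by (auto simp: SC_iff)
  then obtain w where w: "w < n" "d w = c v" by auto
  with ne have "w \<noteq> v" by auto
  moreover from this have "c w = c v" using w same by simp
  ultimately show ?thesis using that[of w] w(1) SC_adj[OF n c w(1) v] by auto
qed

lemma not_connected_4_3:
  "\<not> Digraph_Component.connected (with_proj (strong_colour_graph (cycle_graph 4) 3))"
proof (rule not_connected_frozen)
  fix c d assume "recol 4 3 c d"
  then obtain v where cd: "c \<in> SC 4 3" "d \<in> SC 4 3"
    and v: "v < 4" and same: "\<And>u. u \<noteq> v \<Longrightarrow> d u = c u"
    by (auto simp: recol_def)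
  have "d v = c v"
  proof (rule ccontr)
    assume ne: "d v \<noteq> c v"
    obtain w where w: "w < 4" "w \<noteq> v" "\<not> adj 4 w v" "c w = c v"
      using recol_witness[OF _ cd v same ne] by auto
    obtain w' where w': "w' < 4" "w' \<noteq> v" "\<not> adj 4 w' v" "d w' = d v"
      using recol_witness[OF _ cd(2,1) v, of thesis] same ne by auto
    \<comment> \<open>In a 4-cycle only the opposite vertex is neither \<open>v\<close> nor adjacent
      to \<open>v\<close>. It would have to carry both the old and the new colour.\<close>
    have "w = w'" using v w w' unfolding adj_def by presburger
    then show False using w w' same ne by auto
  qed
  then show "c = d" using same by (metis ext)
next
  fix c assume c: "c \<in> SC 4 3"
  define d where "d = (\<lambda>i\<in>{..<4}. Suc 3 - c i)"
  have "d \<in> SC 4 3" using SC_mirror[OF _ c] by (simp add: d_def)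
  \<comment> \<open>Mirroring fixes only colour 2, which cannot occur on both of two adjacent
    vertices.\<close>
  moreover have "c 0 \<noteq> c 1" using SC_adj[OF _ c, of 0 1] by (auto simp: adj_def)
  then have "c 0 \<noteq> d 0 \<or> c 1 \<noteq> d 1" by (auto simp: d_def)
  ultimately show "\<exists>d\<in>SC 4 3. d \<noteq> c" by metis
qed

section \<open>The 5-cycle with four colours\<close>

definition gap :: "nat \<Rightarrow> nat \<Rightarrow> nat" where
  "gap a b = (b + 4 - a) mod 4"

text \<open>
  The summands run along the complement \<open>0, 2, 4, 1, 3\<close> of the 5-cycle. The repeated colour occupies
  two consecutive positions there, and a recolouring swaps a zero gap with a neighbouring one.
\<close>
definition pentagram_winding :: "(nat \<Rightarrow> nat) \<Rightarrow> nat" where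
  "pentagram_winding c =
     gap (c 0) (c 2) + gap (c 2) (c 4) + gap (c 4) (c 1) + gap (c 1) (c 3) + gap (c 3) (c 0)"

text \<open>The two non-neighbours of \<open>v\<close> are its neighbours in the complement. A
  nontrivial move takes \<open>v\<close> from the colour of one to the colour of the other, so the
  two gaps at \<open>v\<close> merely trade places.\<close>

lemma not_connected_5_4:
  "\<not> Digraph_Component.connected (with_proj (strong_colour_graph (cycle_graph 5) 4))"
proof (rule not_connected_by_invariant)
  fix c d assume "recol 5 4 c d"
  then obtain v where cd: "c \<in> SC 5 4" "d \<in> SC 5 4"
    and v: "v < 5" and same: "\<And>u. u \<noteq> v \<Longrightarrow> d u = c u"
    by (auto simp: recol_def)
  show "pentagram_winding c = pentagram_winding d"
  proof (cases "d v = c v")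
    case True
    then have "d = c" using same by (metis ext)
    then show ?thesis by simp
  next
    case ne: False
    obtain w where w: "w < 5" "w \<noteq> v" "\<not> adj 5 w v" "c w = c v"
      using recol_witness[OF _ cd v same ne] by auto
    obtain w' where w': "w' < 5" "w' \<noteq> v" "\<not> adj 5 w' v" "d w' = d v"
      using recol_witness[OF _ cd(2,1) v, of thesis] same ne by auto
    have cw: "d v = c w'" "c v = c w" using w w' same by auto
    have "w \<noteq> w'" using cw ne by auto
    have g: "gap a a = 0" for a by (simp add: gap_def)
    have "v = 0 \<and> {w, w'} = {2, 3} \<or> v = 1 \<and> {w, w'} = {3, 4} \<or> v = 2 \<and> {w, w'} = {0, 4} \<or>
      v = 3 \<and> {w, w'} = {0, 1} \<or> v = 4 \<and> {w, w'} = {1, 2}"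
    proof -
      have "v \<in> {0,1,2,3,4}" "w \<in> {0,1,2,3,4}" "w' \<in> {0,1,2,3,4}" using v w(1) w'(1) by auto
      with w(2,3) w'(2,3) \<open>w \<noteq> w'\<close> show ?thesis
        unfolding adj_def by (elim insertE emptyE; simp add: doubleton_eq_iff)
    qed
    then show ?thesis
      unfolding pentagram_winding_def using cw same
      by (elim disjE conjE; auto simp: doubleton_eq_iff g)
  qed
next
  \<comment> \<open>Along the complement 0, 2, 4, 1, 3 the colours read 1, 1, 2, 3, 4. The gaps add
    up to 4, those of the mirror image to 12.\<close>
  define c where "c = (\<lambda>i\<in>{..<5}. [1, 3, 1, 4, 2] ! i :: nat)"
  have l5: "{..<5} = {0, 1, 2, 3, 4 :: nat}" by auto
  have "{1..4} = {1, 2, 3, 4 :: nat}" by auto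
  then have "c ` {..<5} = {1..4}" unfolding l5 by (auto simp: c_def)
  moreover have "c i \<noteq> c j" if "i < 5" "j < 5" "adj 5 i j" for i j
  proof -
    have "i \<in> {0,1,2,3,4}" "j \<in> {0,1,2,3,4}" using that by auto
    with that(3) show ?thesis unfolding adj_def by (elim insertE emptyE; simp add: c_def)
  qed
  ultimately show c: "c \<in> SC 5 4" by (simp add: SC_iff c_def)
  show "(\<lambda>i\<in>{..<5}. Suc 4 - c i) \<in> SC 5 4" using SC_mirror[OF _ c] by simp
  show "pentagram_winding c \<noteq> pentagram_winding (\<lambda>i\<in>{..<5}. Suc 4 - c i)"
    by (simp add: pentagram_winding_def gap_def c_def)
qed

lemma not_connected_small:
  assumes "n \<ge> 3" "n \<ge> k + 1" "k \<le> 3 \<or> n \<le> 5"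
  shows "\<not> Digraph_Component.connected (with_proj (strong_colour_graph (cycle_graph n) k))"
proof -
  consider "k \<le> 2" | "k = 3" "n \<noteq> 4" | "k = 3" "n = 4" | "k = 4" "n = 5"
    using assms by linarith
  then show ?thesis
    using assms not_connected_le_2 not_connected_3 not_connected_4_3 not_connected_5_4
    by cases auto
qed

section \<open>Reduction to a shorter cycle\<close>

lemma exists_colour_avoiding:
  fixes a b c k :: nat
  assumes "k \<ge> 4"
  obtains x where "x \<in> {1..k}" "x \<noteq> a" "x \<noteq> b" "x \<noteq> c"
proof -
  have "card {a, b, c} \<le> 3" by (simp add: card_insert_if)
  then have "\<not> {1..k} \<subseteq> {a, b, c}" using assms card_mono[of "{a, b, c}" "{1..k}"] by auto
  then show ?thesis using that by blast
qed

lemma recol_fun_upd: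
  "c(v := x) \<in> SC n k \<Longrightarrow> c(v := y) \<in> SC n k \<Longrightarrow> v < n \<Longrightarrow> reach n k (c(v := x)) (c(v := y))"
  by (intro r_into_rtranclp) (auto simp: recol_def)

text \<open>Deleting vertex \<open>n\<close> from the longer cycle and joining its neighbours
  \<open>0\<close> and \<open>n - 1\<close> yields the shorter one.\<close>

lemma adj_iff_adj_Suc:
  "i < n \<Longrightarrow> j < n \<Longrightarrow> adj n i j \<longleftrightarrow> adj (Suc n) i j \<or> i = 0 \<and> Suc j = n \<or> j = 0 \<and> Suc i = n"
  by (auto simp: adj_def)

lemma SC_extend:
  assumes n: "n \<ge> 3" and f: "f \<in> SC n k" and x: "x \<in> {1..k}" "x \<noteq> f 0" "x \<noteq> f (n - 1)"
  shows "f(n := x) \<in> SC (Suc n) k"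
proof -
  have im: "f(n := x) ` {..<Suc n} = insert x (f ` {..<n})"
    unfolding lessThan_Suc by auto
  have "(f(n := x)) i \<noteq> (f(n := x)) j" if ij: "i < Suc n" "j < Suc n" "adj (Suc n) i j" for i j
  proof (cases "i < n \<and> j < n")
    case True
    then show ?thesis using SC_adj[OF n f, of i j] ij adj_iff_adj_Suc[of i n j] by auto
  next
    case False
    then show ?thesis using ij x n by (auto simp: adj_def less_Suc_eq)
  qed
  with n f x im show ?thesis by (auto simp: SC_iff extensional_def)
qed

lemma SC_extend_new_colour:
  assumes n: "n \<ge> 3" and f: "f \<in> SC n k"
  shows "f(n := Suc k) \<in> SC (Suc n) (Suc k)"
proof -
  have r: "f i \<noteq> Suc k" if "i < n" for i using SC_range[OF n f that] by auto
  have "f(n := Suc k) ` {..<Suc n} = insert (Suc k) (f ` {..<n})"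
    unfolding lessThan_Suc by auto
  also have "\<dots> = {1..Suc k}" using n f by (auto simp: SC_iff)
  finally have im: "f(n := Suc k) ` {..<Suc n} = {1..Suc k}" .
  have "(f(n := Suc k)) i \<noteq> (f(n := Suc k)) j"
    if ij: "i < Suc n" "j < Suc n" "adj (Suc n) i j" for i j
  proof (cases "i < n \<and> j < n")
    case True
    then show ?thesis using SC_adj[OF n f, of i j] ij adj_iff_adj_Suc[of i n j] by auto
  next
    case False
    then show ?thesis using ij r[of i] r[of j] n by (auto simp: adj_def less_Suc_eq)
  qed
  with n f im show ?thesis by (auto simp: SC_iff extensional_def)
qed

text \<open>The vertex \<open>i\<close> keeps the deleted colour present, and \<open>ne\<close>
  makes the new closing edge proper.\<close>

lemma SC_restrict:
  assumes n: "n \<ge> 3" and c: "c \<in> SC (Suc n) k" and i: "i < n" "c i = c n" and ne: "c (n - 1) \<noteq> c 0"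
  shows "restrict c {..<n} \<in> SC n k"
proof -
  have "c n \<in> c ` {..<n}" using i by (metis imageI lessThan_iff)
  then have "c ` {..<n} = c ` {..<Suc n}" unfolding lessThan_Suc by (simp add: insert_absorb)
  also have "\<dots> = {1..k}" using c n by (simp add: SC_iff)
  finally have im: "restrict c {..<n} ` {..<n} = {1..k}" by simp
  have "c i \<noteq> c j" if "i < n" "j < n" "adj n i j" for i j
  proof (cases "adj (Suc n) i j")
    case True
    then show ?thesis using SC_adj[OF _ c, of i j] that n by auto
  next
    case False
    then have "i = 0 \<and> j = n - 1 \<or> j = 0 \<and> i = n - 1" using that adj_iff_adj_Suc[of i n j] by auto
    then show ?thesis using ne by auto
  qed
  with n im show ?thesis by (simp add: SC_iff)
qed

text \<open>Here the colour \<open>Suc k\<close> disappears together with its only vertex.\<close>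

lemma SC_restrict_new_colour:
  assumes n: "n \<ge> 3" and c: "c \<in> SC (Suc n) (Suc k)" and k: "c n = Suc k"
    and uniq: "\<And>i. i < n \<Longrightarrow> c i \<noteq> Suc k" and ne: "c (n - 1) \<noteq> c 0"
  shows "restrict c {..<n} \<in> SC n k"
proof -
  have "insert (Suc k) (c ` {..<n}) = c ` {..<Suc n}" unfolding lessThan_Suc using k by auto
  also have "\<dots> = insert (Suc k) {1..k}" using c n by (auto simp: SC_iff)
  finally have "insert (Suc k) (c ` {..<n}) = insert (Suc k) {1..k}" .
  moreover have "Suc k \<notin> c ` {..<n}" using uniq by (metis imageE lessThan_iff)
  ultimately have im: "restrict c {..<n} ` {..<n} = {1..k}" by (simp add: insert_ident)
  have "c i \<noteq> c j" if "i < n" "j < n" "adj n i j" for i j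
  proof (cases "adj (Suc n) i j")
    case True
    then show ?thesis using SC_adj[OF _ c, of i j] that n by auto
  next
    case False
    then have "i = 0 \<and> j = n - 1 \<or> j = 0 \<and> i = n - 1" using that adj_iff_adj_Suc[of i n j] by auto
    then show ?thesis using ne by auto
  qed
  with n im show ?thesis by (simp add: SC_iff)
qed

lemma restrict_upd_id:
  assumes "n \<ge> 2" "c \<in> SC (Suc n) k"
  shows "(restrict c {..<n})(n := c n) = c"
  using assms by (auto simp: SC_iff extensional_def fun_eq_iff restrict_def)

text \<open>Before each move of the shorter cycle, vertex \<open>n\<close> is parked on a colour
  \<open>z\<close> that is legal both before and after that move.\<close>

lemma reach_lift:
  assumes n: "n \<ge> 3" and k: "k \<ge> 4" and K: "K = k \<or> K = Suc k"
    and "reach n k f g" and f: "f \<in> SC n k" and fx: "f(n := x) \<in> SC (Suc n) K"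
    and "g(n := y) \<in> SC (Suc n) K"
  shows "reach (Suc n) K (f(n := x)) (g(n := y))"
  using assms(4,7)
proof (induction arbitrary: y rule: rtranclp_induct)
  case base
  then show ?case using fx recol_fun_upd by blast
next
  case (step g h)
  then obtain v where v: "v < n" and gh: "g \<in> SC n k" "h \<in> SC n k"
    and same: "\<And>u. u \<noteq> v \<Longrightarrow> h u = g u" by (auto simp: recol_def)
  obtain z where z: "g(n := z) \<in> SC (Suc n) K" "h(n := z) \<in> SC (Suc n) K"
  proof (cases "K = k")
    case True
    obtain z where "z \<in> {1..k}" "z \<noteq> g 0" "z \<noteq> g (n - 1)" "z \<noteq> h v"
      using exists_colour_avoiding[OF k] by metis
    \<comment> \<open>Only \<open>v\<close> changes, so avoiding the old colours of the two ends and
      the new colour of \<open>v\<close> suffices even if \<open>v\<close> is an end. These are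
      three constraints, hence the need for four colours.\<close>
    moreover from this have "z \<noteq> h 0" "z \<noteq> h (n - 1)"
      by (cases "v = 0"; cases "v = n - 1"; simp add: same)+
    ultimately show ?thesis using that True n gh SC_extend by blast
  next
    case False
    then show ?thesis using that K n gh SC_extend_new_colour by blast
  qed
  have "reach (Suc n) K (f(n := x)) (g(n := z))" using step.IH z by blast
  moreover have "reach (Suc n) K (g(n := z)) (h(n := z))"
    using z v same by (intro r_into_rtranclp) (auto simp: recol_def intro!: exI[of _ v])
  moreover have "reach (Suc n) K (h(n := z)) (h(n := y))"
    using z(2) step.prems by (rule recol_fun_upd) simp
  ultimately show ?case by (metis rtranclp_trans)
qed

text \<open>Two obstacles to deleting vertex \<open>n\<close> are removed in turn: its colour may
  occur nowhere else, and its two neighbours may have equal colours.\<close>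

lemma reach_restrictable:
  assumes n: "n \<ge> 5" and k: "k \<ge> 4" "k < n" and c: "c \<in> SC (Suc n) k"
  obtains d where "reach (Suc n) k c d" "restrict d {..<n} \<in> SC n k"
proof -
  have n3: "n \<ge> 3" "Suc n \<ge> 3" using n by auto
  obtain d i where d: "reach (Suc n) k c d" "d \<in> SC (Suc n) k" and i: "i < n" "d i = d n"
  proof (cases "\<exists>i<n. c i = c n")
    case True
    then show ?thesis using that c by blast
  next
    case False
    \<comment> \<open>Pigeonhole on all vertices except \<open>n - 1\<close>, a neighbour of
      \<open>n\<close>. As the colour of \<open>n\<close> is unique here, the equal pair also avoids
      \<open>n\<close>.\<close>
    let ?U = "insert n {..<n - 1}"
    have "card ?U = n" using n by simp
    moreover have "card {1..k} = k" by simp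
    moreover have "c ` ?U \<subseteq> {1..k}" using SC_range[OF n3(2) c] by force
    ultimately have "\<not> inj_on c ?U" using k by (metis card_inj_on_le finite_atLeastAtMost not_less)
    then obtain u w where uw: "u \<in> ?U" "w \<in> ?U" "u \<noteq> w" "c u = c w" by (auto simp: inj_on_def)
    have "u \<noteq> n"
    proof
      assume "u = n"
      with uw have "w < n" "c w = c n" by auto
      with False show False by blast
    qed
    moreover have "w \<noteq> n"
    proof
      assume "w = n"
      with uw have "u < n" "c u = c n" by auto
      with False show False by blast
    qed
    ultimately have lt: "u < n - 1" "w < n - 1" using uw by auto
    \<comment> \<open>One vertex of the pair is not \<open>0\<close>, hence not adjacent to
      \<open>n\<close>, and can safely take the colour of \<open>n\<close>.\<close>
    obtain u w where uw: "0 < u" "u < n - 1" "w < n" "w \<noteq> u" "c w = c u"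
      using uw lt that[of u w] that[of w u] by (cases "u = 0") auto
    have x: "c n \<in> {1..k}" using SC_range[OF n3(2) c] by simp
    have nb: "c v \<noteq> c n" if "v < Suc n" "adj (Suc n) v u" for v
    proof -
      have "v \<noteq> n" using that uw by (auto simp: adj_def)
      then show ?thesis using False that by auto
    qed
    have "c(u := c n) \<in> SC (Suc n) k" "reach (Suc n) k c (c(u := c n))"
      using SC_recol[OF n3(2) c, of u w "c n"] uw x nb by auto
    then show ?thesis using that[of "c(u := c n)" u] uw by auto
  qed
  show ?thesis
  proof (cases "d (n - 1) = d 0")
    case False
    then show ?thesis using that d SC_restrict[OF n3(1) d(2) i] by blast
  next
    case True
    \<comment> \<open>Vertex \<open>n - 1\<close> is recoloured: \<open>x\<close> must differ from
      its two neighbours and from vertex \<open>0\<close>, which retains the colour given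
      up.\<close>
    obtain x where x: "x \<in> {1..k}" "x \<noteq> d 0" "x \<noteq> d n" "x \<noteq> d (n - 2)"
      using exists_colour_avoiding[OF k(1)] by metis
    let ?e = "d(n - 1 := x)"
    have "d u \<noteq> x" if "u < Suc n" "adj (Suc n) u (n - 1)" for u
    proof -
      have "u = n \<or> u = n - 2" using that n by (auto simp: adj_def)
      then show ?thesis using x by auto
    qed
    then have e: "?e \<in> SC (Suc n) k" "reach (Suc n) k d ?e"
      using SC_recol[OF n3(2) d(2), of "n - 1" 0 x] x n True by auto
    have "d (n - 1) \<noteq> d n" using SC_adj[OF n3(2) d(2), of "n - 1" n] n by (auto simp: adj_def)
    then have "i \<noteq> n - 1" using i by auto
    then have "restrict ?e {..<n} \<in> SC n k"
      using SC_restrict[OF n3(1) e(1), of i] i x n by auto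
    then show ?thesis using that d(1) e(2) by (meson rtranclp_trans)
  qed
qed

section \<open>One more vertex than colours: the sliding puzzle\<close>

text \<open>
  When \<open>k = n - 1\<close>, every colour but that of the hole is seen as a token; the colour of the hole
  itself always repeats one of the tokens.
\<close>
definition hole :: "nat \<Rightarrow> (nat \<Rightarrow> nat) \<Rightarrow> nat \<Rightarrow> bool" where
  "hole n c h \<longleftrightarrow> h < n \<and> inj_on c ({..<n} - {h})"

lemma hole_exists:
  assumes "n \<ge> 2" and c: "c \<in> SC (Suc n) n"
  obtains h where "hole (Suc n) c h"
proof -
  have im: "c ` {..<Suc n} = {1..n}" using c assms by (simp add: SC_iff)
  then have "card (c ` {..<Suc n}) \<noteq> card {..<Suc n}" by simp
  then have "\<not> inj_on c {..<Suc n}" using card_image by blast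
  then obtain h w where hw: "h < Suc n" "w < Suc n" "h \<noteq> w" "c h = c w" by (auto simp: inj_on_def)
  \<comment> \<open>Dropping \<open>h\<close> loses no colour because \<open>w\<close> shares it.
    The remaining \<open>n\<close> vertices carry \<open>n\<close> colours, so injectively.\<close>
  have "c ` ({..<Suc n} - {h}) = {1..n}"
    unfolding im[symmetric] using hw by (auto simp: image_iff)
  then have "inj_on c ({..<Suc n} - {h})" using hw by (intro eq_card_imp_inj_on) auto
  then show ?thesis using that hw by (auto simp: hole_def)
qed

lemma hole_image:
  assumes "n \<ge> 2" and c: "c \<in> SC (Suc n) n" and h: "hole (Suc n) c h"
  shows "c ` ({..<Suc n} - {h}) = {1..n}"
proof (rule card_subset_eq)
  show "c ` ({..<Suc n} - {h}) \<subseteq> {1..n}" using c assms by (auto simp: SC_iff)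
  show "card (c ` ({..<Suc n} - {h})) = card {1..n}"
    using h by (subst card_image) (auto simp: hole_def)
qed simp

text \<open>Every colour sits on some token, so the hole may give up its own colour freely.\<close>

lemma hole_recol:
  assumes n: "n \<ge> 2" and c: "c \<in> SC (Suc n) n" and h: "hole (Suc n) c h"
    and x: "x \<in> {1..n}" "\<And>u. u < Suc n \<Longrightarrow> adj (Suc n) u h \<Longrightarrow> c u \<noteq> x"
  shows "c(h := x) \<in> SC (Suc n) n" and "reach (Suc n) n c (c(h := x))"
proof -
  have hn: "h < Suc n" using h by (simp add: hole_def)
  then have "c h \<in> c ` ({..<Suc n} - {h})"
    unfolding hole_image[OF n c h] using SC_range[OF _ c] n by simp
  then obtain w where "c h = c w" "w \<in> {..<Suc n} - {h}" by (rule imageE)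
  then have w: "w < Suc n" "w \<noteq> h" "c w = c h" by simp_all
  have "Suc n \<ge> 3" using n by simp
  note SC_recol[OF this c hn w x]
  then show "c(h := x) \<in> SC (Suc n) n" "reach (Suc n) n c (c(h := x))" by simp_all
qed

text \<open>The hole copies the colour of a non-neighbour \<open>w\<close>. The two vertices now
  agree, and regarding \<open>w\<close> as the hole means that the token has slid from
  \<open>w\<close> to \<open>h\<close>.\<close>

lemma slide:
  assumes n: "n \<ge> 2" and c: "c \<in> SC (Suc n) n" and h: "hole (Suc n) c h"
    and w: "w < Suc n" "w \<noteq> h" "\<not> adj (Suc n) w h"
  shows "c(h := c w) \<in> SC (Suc n) n" "reach (Suc n) n c (c(h := c w))" "hole (Suc n) (c(h := c w)) w"
proof -
  have inj: "inj_on c ({..<Suc n} - {h})" and hn: "h < Suc n" using h by (auto simp: hole_def)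
  have "c u \<noteq> c w" if u: "u < Suc n" "adj (Suc n) u h" for u
  proof -
    have "u \<noteq> w" "u \<noteq> h" using u w n by (auto simp: adj_def)
    then show ?thesis using inj_onD[OF inj, of u w] u w by auto
  qed
  then show "c(h := c w) \<in> SC (Suc n) n" "reach (Suc n) n c (c(h := c w))"
    using hole_recol[OF n c h, of "c w"] SC_range[OF _ c w(1)] n by auto
  show "hole (Suc n) (c(h := c w)) w"
    unfolding hole_def
  proof (intro conjI inj_onI)
    fix u v assume uv: "u \<in> {..<Suc n} - {w}" "v \<in> {..<Suc n} - {w}"
      and eq: "(c(h := c w)) u = (c(h := c w)) v"
    show "u = v"
      using uv eq w inj_onD[OF inj, of u v] inj_onD[OF inj, of u w] inj_onD[OF inj, of w v]
      by (cases "u = h"; cases "v = h") auto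
  qed (use w in simp)
qed

text \<open>The ends of the edge, their outer neighbours \<open>x\<close> and \<open>y\<close>, and
  \<open>p\<close> rule out at most five vertices.\<close>

lemma common_non_neighbour:
  assumes n: "n \<ge> 6" and ab: "a < n" "b < n" "adj n a b"
  obtains m where "m < n" "m \<noteq> a" "m \<noteq> b" "m \<noteq> p" "\<not> adj n m a" "\<not> adj n m b"
proof -
  define pred where "pred i = (if i = 0 then n - 1 else i - 1)" for i
  define succ where "succ i = (if Suc i = n then 0 else Suc i)" for i
  have adj: "adj n m i \<longleftrightarrow> m = pred i \<or> m = succ i" if "m < n" "i < n" for m i
    using that n by (auto simp: adj_def pred_def succ_def)
  have inv: "succ (pred i) = i" "pred (succ i) = i" if "i < n" for i
    using that n by (auto simp: pred_def succ_def)
  define x where "x = (if a = pred b then pred a else succ a)"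
  define y where "y = (if a = pred b then succ b else pred b)"
  have "card (set [a, b, p, x, y]) \<le> 5" using card_length[of "[a, b, p, x, y]"] by simp
  with n have "card (set [a, b, p, x, y]) < card {..<n}" unfolding card_lessThan by linarith
  then have "\<not> {..<n} \<subseteq> set [a, b, p, x, y]" by (meson card_mono finite_set not_less)
  then obtain m where m: "m < n" "m \<noteq> a" "m \<noteq> b" "m \<noteq> p" "m \<noteq> x" "m \<noteq> y" by auto
  have "a = pred b \<or> a = succ b" using adj[of a b] ab by simp
  then have "\<not> adj n m a \<and> \<not> adj n m b"
  proof
    assume "a = pred b"
    then have "succ a = b" "x = pred a" "y = succ b" using inv ab by (auto simp: x_def y_def)
    with m \<open>a = pred b\<close> show ?thesis using adj[of m] ab by metis
  next
    assume "a = succ b"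
    moreover from this have "a \<noteq> pred b" using n ab by (auto simp: pred_def succ_def split: if_splits)
    ultimately have "pred a = b" "x = succ a" "y = pred b" using inv ab by (auto simp: x_def y_def)
    with m \<open>a = succ b\<close> show ?thesis using adj[of m] ab by metis
  qed
  then show ?thesis using that m by blast
qed

text \<open>One slide suffices if \<open>t\<close> and \<open>h\<close> are not adjacent on the
  cycle; otherwise two slides through a common non-neighbour do. Neither route touches
  \<open>p\<close>.\<close>

lemma move_hole:
  assumes n: "n \<ge> 5" and c: "c \<in> SC (Suc n) n" and h: "hole (Suc n) c h"
    and p: "p \<noteq> h" and t: "t < Suc n" "t \<noteq> p"
  obtains d where "d \<in> SC (Suc n) n" "reach (Suc n) n c d" "hole (Suc n) d t" "d p = c p"
proof -
  have n2: "n \<ge> 2" using n by simp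
  have hn: "h < Suc n" using h by (simp add: hole_def)
  consider "t = h" | "t \<noteq> h" "\<not> adj (Suc n) t h" | "adj (Suc n) t h" by blast
  then show ?thesis
  proof cases
    case 1
    then show ?thesis using that c h by blast
  next
    case 2
    then show ?thesis using that slide[OF n2 c h t(1)] p by simp
  next
    case 3
    obtain m where m: "m < Suc n" "m \<noteq> t" "m \<noteq> h" "m \<noteq> p" "\<not> adj (Suc n) m t" "\<not> adj (Suc n) m h"
      using common_non_neighbour[OF _ t(1) hn 3] n by auto
    note s1 = slide[OF n2 c h m(1,3,6)]
    note s2 = slide[OF n2 s1(1,3) t(1) m(2)[symmetric]]
    have "\<not> adj (Suc n) t m" using m(5) adj_sym by blast
    note s2 = s2[OF this]
    show ?thesis using that[OF s2(1) rtranclp_trans[OF s1(2) s2(2)] s2(3)] m(4) p by simp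
  qed
qed

text \<open>To slide the token of colour \<open>n\<close> to vertex \<open>n\<close>, the hole is
  first brought there while the token is held in place.\<close>

lemma reach_colour_at_end:
  assumes n: "n \<ge> 5" and c: "c \<in> SC (Suc n) n"
  obtains d h where "reach (Suc n) n c d" "d \<in> SC (Suc n) n" "hole (Suc n) d h" "h \<noteq> n" "d n = n"
proof -
  have n2: "n \<ge> 2" using n by simp
  obtain h where h: "hole (Suc n) c h" using hole_exists[OF n2 c] .
  have "n \<in> c ` ({..<Suc n} - {h})" unfolding hole_image[OF n2 c h] using n by simp
  then obtain p where "n = c p" and ph: "p \<in> {..<Suc n} - {h}" by (rule imageE)
  then have p: "p < Suc n" "p \<noteq> h" "c p = n" by simp_all
  show ?thesis
  proof (cases "p = n")
    case True
    then show ?thesis using that c h p by blast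
  next
    case pn: False
    \<comment> \<open>A token adjacent to vertex \<open>n\<close> cannot slide there directly, so it
      is first moved to a vertex \<open>q\<close> that is not adjacent to it.\<close>
    obtain d q h' where d: "reach (Suc n) n c d" "d \<in> SC (Suc n) n" "hole (Suc n) d h'"
      and q: "q < Suc n" "q \<noteq> n" "q \<noteq> h'" "\<not> adj (Suc n) q n" "d q = n"
    proof (cases "adj (Suc n) p n")
      case False
      then show ?thesis using that c h p pn by blast
    next
      case True
      obtain q where q: "q < Suc n" "q \<noteq> p" "q \<noteq> n" "\<not> adj (Suc n) q p" "\<not> adj (Suc n) q n"
        using common_non_neighbour[OF _ p(1) _ True] n by auto
      obtain d where d: "d \<in> SC (Suc n) n" "reach (Suc n) n c d" "hole (Suc n) d q" "d p = c p"
        using move_hole[OF n c h p(2) q(1,2)] .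
      have "\<not> adj (Suc n) p q" using q(4) adj_sym by blast
      note s = slide[OF n2 d(1,3) p(1) q(2)[symmetric] this]
      show ?thesis
        by (rule that[OF _ s(1,3), of q]) (use d s(2) q p in auto)
    qed
    obtain e where e: "e \<in> SC (Suc n) n" "reach (Suc n) n d e" "hole (Suc n) e n" "e q = d q"
      using move_hole[OF n d(2,3) q(3) _ q(2)[symmetric]] by auto
    note s = slide[OF n2 e(1,3) q(1,2,4)]
    show ?thesis
      by (rule that[OF _ s(1,3)]) (use d(1) e s(2) q in auto)
  qed
qed

text \<open>Once the token of colour \<open>n\<close> is at vertex \<open>n\<close>, the hole may
  still repeat that colour or spoil the closing edge. Recolouring the hole cures both.\<close>

lemma reach_restrictable_new_colour:
  assumes n: "n \<ge> 5" and c: "c \<in> SC (Suc n) n"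
  obtains d where "reach (Suc n) n c d" "restrict d {..<n} \<in> SC n (n - 1)"
proof -
  have n2: "n \<ge> 2" "n \<ge> 3" using n by auto
  obtain d h where d: "reach (Suc n) n c d" "d \<in> SC (Suc n) n"
    and h: "hole (Suc n) d h" "h \<noteq> n" and dn: "d n = n"
    using reach_colour_at_end[OF n c] .
  have inj: "inj_on d ({..<Suc n} - {h})" and hn: "h < n" using h by (auto simp: hole_def)
  \<comment> \<open>\<open>a\<close> and \<open>b\<close> are the neighbours of \<open>h\<close> in
    the shorter cycle, so the closing edge is taken into account.\<close>
  define a where "a = (if h = 0 then n - 1 else h - 1)"
  define b where "b = (if h = n - 1 then 0 else Suc h)"
  obtain x where x: "x \<in> {1..n}" "x \<noteq> n" "x \<noteq> d a" "x \<noteq> d b"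
    using exists_colour_avoiding[of n n "d a" "d b"] n by auto
  have nb: "d u \<noteq> x" if "u < Suc n" "adj (Suc n) u h" for u
  proof -
    have "u = n \<or> u = a \<or> u = b" using that hn by (auto simp: adj_def a_def b_def)
    then show ?thesis using x dn by auto
  qed
  let ?e = "d(h := x)"
  note e = hole_recol[OF n2(1) d(2) h(1) x(1) nb]
  have uniq: "?e i \<noteq> n" if "i < n" for i
    using that inj_onD[OF inj, of i n] dn h(2) x(2) by auto
  have "?e (n - 1) \<noteq> ?e 0"
  proof -
    consider "h = 0" | "h = n - 1" | "h \<noteq> 0" "h \<noteq> n - 1" by blast
    then show ?thesis
    proof cases
      case 3
      have "n - 1 \<in> {..<Suc n} - {h}" "0 \<in> {..<Suc n} - {h}" "n - 1 \<noteq> 0" using 3 n by auto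
      then have "d (n - 1) \<noteq> d 0" using inj by (metis inj_onD)
      then show ?thesis using 3 by simp
    qed (use x n in \<open>auto simp: a_def b_def\<close>)
  qed
  then have "restrict ?e {..<n} \<in> SC n (n - 1)"
    using SC_restrict_new_colour[OF n2(2), of ?e "n - 1"] e(1) uniq dn h(2) n by auto
  then show ?thesis using that d(1) e(2) by (meson rtranclp_trans)
qed

section \<open>From the 5-cycle to the 6-cycle\<close>

text \<open>Both colourings are moved to deletable ones, which \<open>lift\<close> connects. Lifting
  is a hypothesis because the shorter cycle need not have a connected colour graph.\<close>

lemma reach_all_Suc:
  assumes n: "n \<ge> 2"
    and lift: "\<And>f g x y. f \<in> SC n k \<Longrightarrow> g \<in> SC n k \<Longrightarrow>
      f(n := x) \<in> SC (Suc n) K \<Longrightarrow> g(n := y) \<in> SC (Suc n) K \<Longrightarrow>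
      reach (Suc n) K (f(n := x)) (g(n := y))"
    and restr: "\<And>c. c \<in> SC (Suc n) K \<Longrightarrow> \<exists>d. reach (Suc n) K c d \<and> restrict d {..<n} \<in> SC n k"
    and cd: "c \<in> SC (Suc n) K" "d \<in> SC (Suc n) K"
  shows "reach (Suc n) K c d"
proof -
  obtain c' where c': "reach (Suc n) K c c'" "restrict c' {..<n} \<in> SC n k" using restr cd by blast
  obtain d' where d': "reach (Suc n) K d d'" "restrict d' {..<n} \<in> SC n k" using restr cd by blast
  have "c' \<in> SC (Suc n) K" "d' \<in> SC (Suc n) K" using reach_SC c' d' cd by blast+
  then have "reach (Suc n) K c' d'"
    using lift[OF c'(2) d'(2), of "c' n" "d' n"] restrict_upd_id[OF n] by metis
  with c'(1) reach_sym[OF d'(1)] show ?thesis by (metis rtranclp_trans)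
qed

text \<open>As lists, concrete colourings can be checked for membership and moved by
  simplification.\<close>

definition list_colouring :: "nat list \<Rightarrow> nat \<Rightarrow> nat" where
  "list_colouring xs = (\<lambda>i\<in>{..<length xs}. xs ! i)"

lemma list_colouring_nth: "i < length xs \<Longrightarrow> list_colouring xs i = xs ! i"
  by (simp add: list_colouring_def)

lemma list_colouring_in_SC:
  assumes n: "length xs = n" "n \<ge> 3"
  shows "list_colouring xs \<in> SC n k \<longleftrightarrow>
    set xs = {1..k} \<and> successively (\<noteq>) xs \<and> last xs \<noteq> hd xs"
proof -
  have im: "list_colouring xs ` {..<n} = set xs"
    using n by (auto simp: list_colouring_nth set_conv_nth)
  have "xs \<noteq> []" using n by auto
  then have hl: "hd xs = xs ! 0" "last xs = xs ! (n - 1)"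
    using n by (simp_all add: hd_conv_nth last_conv_nth)
  have "(\<forall>i<n. \<forall>j<n. adj n i j \<longrightarrow> list_colouring xs i \<noteq> list_colouring xs j) \<longleftrightarrow>
      (\<forall>i<n. \<forall>j<n. adj n i j \<longrightarrow> xs ! i \<noteq> xs ! j)"
    using n by (simp add: list_colouring_nth)
  also have "\<dots> \<longleftrightarrow> (\<forall>i. Suc i < n \<longrightarrow> xs ! i \<noteq> xs ! Suc i) \<and> xs ! (n - 1) \<noteq> xs ! 0"
  proof
    assume *: "\<forall>i<n. \<forall>j<n. adj n i j \<longrightarrow> xs ! i \<noteq> xs ! j"
    have "adj n i (Suc i)" for i by (simp add: adj_def)
    moreover have "adj n (n - 1) 0" "n - 1 < n" "0 < n" using n by (auto simp: adj_def)
    ultimately show "(\<forall>i. Suc i < n \<longrightarrow> xs ! i \<noteq> xs ! Suc i) \<and> xs ! (n - 1) \<noteq> xs ! 0"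
      using * by (meson Suc_lessD)
  next
    assume *: "(\<forall>i. Suc i < n \<longrightarrow> xs ! i \<noteq> xs ! Suc i) \<and> xs ! (n - 1) \<noteq> xs ! 0"
    show "\<forall>i<n. \<forall>j<n. adj n i j \<longrightarrow> xs ! i \<noteq> xs ! j"
    proof (intro allI impI)
      fix i j assume ij: "i < n" "j < n" "adj n i j"
      then have "j = Suc i \<or> i = Suc j \<or> i = 0 \<and> j = n - 1 \<or> j = 0 \<and> i = n - 1"
        unfolding adj_def by linarith
      then show "xs ! i \<noteq> xs ! j" using * ij by metis
    qed
  qed
  also have "\<dots> \<longleftrightarrow> successively (\<noteq>) xs \<and> last xs \<noteq> hd xs"
    using n hl by (simp add: successively_conv_nth)
  finally show ?thesis using n im by (simp add: SC_iff) (simp add: list_colouring_def)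
qed

lemma list_colouring_update:
  "v < length xs \<Longrightarrow> list_colouring (xs[v := x]) = (list_colouring xs)(v := x)"
  by (rule ext) (simp add: list_colouring_def)

lemma list_colouring_append:
  "list_colouring (xs @ [x]) = (list_colouring xs)(length xs := x)"
  by (rule ext) (simp add: list_colouring_def nth_append)

lemma list_colouring_recol:
  assumes "list_colouring xs \<in> SC n k" "list_colouring (xs[v := x]) \<in> SC n k"
    "length xs = n" "v < n"
  shows "reach n k (list_colouring xs) (list_colouring (xs[v := x]))"
proof -
  have "recol n k (list_colouring xs) (list_colouring (xs[v := x]))"
    using assms by (auto simp: recol_def list_colouring_update)
  then show ?thesis by (rule r_into_rtranclp[of "recol n k"])
qed

lemma list_colouring_of_SC_5:
  assumes "f \<in> SC 5 k"
  shows "f = list_colouring [f 0, f 1, f 2, f 3, f 4]"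
proof
  fix i :: nat
  consider "i = 0" | "i = 1" | "i = 2" | "i = 3" | "i = 4" | "i \<ge> 5" by linarith
  then show "f i = list_colouring [f 0, f 1, f 2, f 3, f 4] i"
    using assms by cases (auto simp: SC_iff list_colouring_def extensional_def)
qed

text \<open>The hole is at vertex 0; along the complement the tokens come in the cyclic order \<open>p, s, q, r\<close>.\<close>
definition pent :: "nat \<Rightarrow> nat \<Rightarrow> nat \<Rightarrow> nat \<Rightarrow> nat list" where
  "pent p q r s = [p, q, p, r, s]"

definition all4 :: "nat \<Rightarrow> nat \<Rightarrow> nat \<Rightarrow> nat \<Rightarrow> bool" where
  "all4 p q r s \<longleftrightarrow> {p, q, r, s} = {1..4} \<and> distinct [p, q, r, s]"

lemma all4I: "{p, q, r, s} = {1..4} \<Longrightarrow> all4 p q r s"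
  unfolding all4_def using card_distinct[of "[p, q, r, s]"] by simp

lemma list_colouring_in_SC_5:
  assumes "all4 p q r s" "set xs = {p, q, r, s}" "length xs = 5" "successively (\<noteq>) xs" "last xs \<noteq> hd xs"
  shows "list_colouring xs \<in> SC 5 4"
  using assms by (simp add: list_colouring_in_SC all4_def)

text \<open>The hole goes once round the complement, through 2, 4, 1, 3, 0. Every token advances by
  one place and the cyclic order stays the same.\<close>

lemma pent_rotate:
  assumes "all4 p q r s"
  shows "reach 5 4 (list_colouring (pent p q r s)) (list_colouring (pent s r p q))"
proof -
  have d: "p \<noteq> q" "p \<noteq> r" "p \<noteq> s" "q \<noteq> r" "q \<noteq> s" "r \<noteq> s"
    using assms by (auto simp: all4_def)
  have i: "list_colouring [p, q, p, r, s] \<in> SC 5 4" "list_colouring [p, q, s, r, s] \<in> SC 5 4"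
    "list_colouring [p, q, s, r, q] \<in> SC 5 4" "list_colouring [p, r, s, r, q] \<in> SC 5 4"
    "list_colouring [p, r, s, p, q] \<in> SC 5 4" "list_colouring [s, r, s, p, q] \<in> SC 5 4"
    by (rule list_colouring_in_SC_5[OF assms]; use d in \<open>simp add: insert_commute\<close>)+
  have "reach 5 4 (list_colouring [p, q, p, r, s]) (list_colouring [p, q, s, r, s])"
    using list_colouring_recol[OF i(1), of 2 s] i(2) by simp
  moreover have "reach 5 4 (list_colouring [p, q, s, r, s]) (list_colouring [p, q, s, r, q])"
    using list_colouring_recol[OF i(2), of 4 q] i(3) by simp
  moreover have "reach 5 4 (list_colouring [p, q, s, r, q]) (list_colouring [p, r, s, r, q])"
    using list_colouring_recol[OF i(3), of 1 r] i(4) by simp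
  moreover have "reach 5 4 (list_colouring [p, r, s, r, q]) (list_colouring [p, r, s, p, q])"
    using list_colouring_recol[OF i(4), of 3 p] i(5) by simp
  moreover have "reach 5 4 (list_colouring [p, r, s, p, q]) (list_colouring [s, r, s, p, q])"
    using list_colouring_recol[OF i(5), of 0 s] i(6) by simp
  ultimately show ?thesis unfolding pent_def by (meson rtranclp_trans)
qed

text \<open>The equal pair occupies one of the five edges of the complement; \<open>p1\<close> to
  \<open>p5\<close> treat 02, 03, 24, 13 and 14. One move leads from \<open>p2\<close> and
  \<open>p3\<close> to \<open>p1\<close>, from \<open>p4\<close> to \<open>p2\<close>, and from
  \<open>p5\<close> to \<open>p3\<close>.\<close>

lemma reach_pent:
  assumes f: "f \<in> SC 5 4"
  obtains p q r s where "all4 p q r s" "reach 5 4 f (list_colouring (pent p q r s))"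
proof -
  define P where "P xs \<longleftrightarrow> (\<exists>p q r s. all4 p q r s \<and>
    reach 5 4 (list_colouring xs) (list_colouring (pent p q r s)))" for xs
  have step: "P xs"
    if "all4 p q r s" "set xs = {p, q, r, s}" "length xs = 5" "successively (\<noteq>) xs" "last xs \<noteq> hd xs"
      "set ys = {p, q, r, s}" "length ys = 5" "successively (\<noteq>) ys" "last ys \<noteq> hd ys"
      "ys = xs[v := x]" "v < 5" "P ys" for xs ys v x p q r s
  proof -
    have "reach 5 4 (list_colouring xs) (list_colouring ys)"
      using list_colouring_recol[of xs 5 4 v x] list_colouring_in_SC_5[OF that(1-5)]
        list_colouring_in_SC_5[OF that(1,6-9)] that by simp
    with \<open>P ys\<close> show ?thesis unfolding P_def by (meson rtranclp_trans)
  qed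
  have p1: "P [a, b, a, c, d]" if "all4 a b c d" for a b c d
    using that unfolding P_def pent_def by blast
  have p2: "P [a, b, c, a, d]" if "all4 a b c d" for a b c d
  proof (rule step[OF that, where ys = "[c, b, c, a, d]" and v = 0 and x = c])
    have "all4 c b a d" using that by (auto simp: all4_def)
    then show "P [c, b, c, a, d]" by (rule p1)
  qed (use that in \<open>auto simp: all4_def\<close>)
  have p3: "P [a, b, c, d, c]" if "all4 a b c d" for a b c d
  proof (rule step[OF that, where ys = "[a, b, a, d, c]" and v = 2 and x = a])
    have "all4 a b d c" using that by (auto simp: all4_def)
    then show "P [a, b, a, d, c]" by (rule p1)
  qed (use that in \<open>auto simp: all4_def\<close>)
  have p4: "P [a, b, c, b, d]" if "all4 a b c d" for a b c d
  proof (rule step[OF that, where ys = "[a, b, c, a, d]" and v = 3 and x = a])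
    show "P [a, b, c, a, d]" using that by (rule p2)
  qed (use that in \<open>auto simp: all4_def\<close>)
  have p5: "P [a, b, c, d, b]" if "all4 a b c d" for a b c d
  proof (rule step[OF that, where ys = "[a, b, c, d, c]" and v = 4 and x = c])
    show "P [a, b, c, d, c]" using that by (rule p3)
  qed (use that in \<open>auto simp: all4_def\<close>)
  obtain a b c d e where F: "f = list_colouring [a, b, c, d, e]"
    using list_colouring_of_SC_5[OF f] by blast
  have s: "{a, b, c, d, e} = {1..4}" "a \<noteq> b" "b \<noteq> c" "c \<noteq> d" "d \<noteq> e" "e \<noteq> a"
    using f unfolding F by (simp_all add: list_colouring_in_SC)
  have "\<not> distinct [a, b, c, d, e]"
  proof
    assume "distinct [a, b, c, d, e]"
    then have "card {a, b, c, d, e} = 5" using distinct_card by fastforce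
    then show False using s(1) by simp
  qed
  then consider "a = c" | "a = d" | "c = e" | "b = d" | "b = e" using s by auto
  then have "P [a, b, c, d, e]"
  proof cases
    case 1
    then have "{a, b, d, e} = {1..4}" using s(1) by (simp add: insert_commute)
    then show ?thesis using p1 all4I 1 by blast
  next
    case 2
    then have "{a, b, c, e} = {1..4}" using s(1) by (simp add: insert_commute)
    then show ?thesis using p2 all4I 2 by blast
  next
    case 3
    then have "{a, b, c, d} = {1..4}" using s(1) by (simp add: insert_commute)
    then show ?thesis using p3 all4I 3 by blast
  next
    case 4
    then have "{a, b, c, e} = {1..4}" using s(1) by (simp add: insert_commute)
    then show ?thesis using p4 all4I 4 by blast
  next
    case 5
    then have "{a, b, c, d} = {1..4}" using s(1) by (simp add: insert_commute)
    then show ?thesis using p5 all4I 5 by blast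
  qed
  then show ?thesis using that unfolding P_def F by blast
qed

text \<open>On the cyclic order, \<open>rotate\<close> is a 4-cycle and \<open>swap\<close>
  transposes two consecutive tokens; together they generate all permutations. The proof brings 1 to
  the front, then 2 behind it, then sorts 3 and 4.\<close>

lemma four_permutations:
  assumes trans: "\<And>xs ys zs. R xs ys \<Longrightarrow> R ys zs \<Longrightarrow> R xs zs"
    and rotate: "\<And>p q r s. all4 p q r s \<Longrightarrow> R (pent p q r s) (pent s r p q)"
    and swap: "\<And>p q r s. all4 p q r s \<Longrightarrow> R (pent p q r s) (pent s q r p)"
    and all4: "all4 p q r s"
  shows "R (pent p q r s) (pent 1 2 3 4)"
proof -
  have perm: "all4 s r p q" "all4 s q r p" "all4 p r s q" if "all4 p q r s" for p q r s
    using that by (auto simp: all4_def)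
  have cycle: "R (pent p q r s) (pent p r s q)" if "all4 p q r s" for p q r s
    using trans[OF swap[OF that] rotate[OF perm(2)[OF that]]] .
  have first: "\<exists>q' r' s'. all4 1 q' r' s' \<and> R (pent p q r s) (pent 1 q' r' s')"
    if a: "all4 p q r s" for p q r s
  proof -
    \<comment> \<open>Reflexivity is not assumed; it comes from applying the 3-cycle three
      times.\<close>
    have "R (pent p q r s) (pent p q r s)"
      using cycle[OF a] cycle[OF perm(3)[OF a]] cycle[OF perm(3)[OF perm(3)[OF a]]] trans by blast
    moreover have "R (pent p q r s) (pent s q r p)" using swap[OF a] .
    moreover have "R (pent p q r s) (pent q r s p)"
      using trans[OF cycle[OF a] swap[OF perm(3)[OF a]]] .
    moreover have "R (pent p q r s) (pent r s q p)"
      using trans[OF cycle[OF a] trans[OF cycle[OF perm(3)[OF a]] swap[OF perm(3)[OF perm(3)[OF a]]]]] .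
    moreover have "1 \<in> {p, q, r, s}" using a by (simp add: all4_def)
    moreover have "all4 q r s p" "all4 r s q p" using a by (auto simp: all4_def)
    ultimately show ?thesis using a perm(2)[OF a] by auto
  qed
  have second: "R (pent 1 q r s) (pent 1 2 3 4) \<or> R (pent 1 q r s) (pent 1 2 4 3)"
    if a: "all4 1 q r s" for q r s
  proof -
    have c1: "R (pent 1 q r s) (pent 1 r s q)" using cycle[OF a] .
    have c2: "R (pent 1 q r s) (pent 1 s q r)" using trans[OF c1 cycle[OF perm(3)[OF a]]] .
    have c3: "R (pent 1 q r s) (pent 1 q r s)" using trans[OF c2 cycle[OF perm(3)[OF perm(3)[OF a]]]] .
    have "2 \<in> {1, q, r, s}" "3 \<in> {1, q, r, s}" "4 \<in> {1, q, r, s}"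
      using a by (simp_all add: all4_def)
    then show ?thesis using c1 c2 c3 by auto
  qed
  have last: "R (pent p q r s) (pent p q s r)" if a: "all4 p q r s" for p q r s
  proof -
    have "R (pent p q r s) (pent q p s r)"
      using trans[OF rotate[OF a] rotate[OF perm(1)[OF a]]] .
    moreover have b: "all4 q p s r" using a by (auto simp: all4_def)
    have "R (pent q p s r) (pent p s r q)"
      using trans[OF cycle[OF b] swap[OF perm(3)[OF b]]] .
    moreover have c: "all4 p s r q" using a by (auto simp: all4_def)
    have "R (pent p s r q) (pent p q s r)"
      using trans[OF cycle[OF c] cycle[OF perm(3)[OF c]]] .
    ultimately show ?thesis using trans by blast
  qed
  obtain q' r' s' where 1: "all4 1 q' r' s'" "R (pent p q r s) (pent 1 q' r' s')"
    using first[OF all4] by blast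
  have "{1, 2, 4, 3} = {1..4 :: nat}" by auto
  then have "R (pent 1 2 4 3) (pent 1 2 3 4)" using last all4I by blast
  then show ?thesis using trans[OF 1(2)] second[OF 1(1)] trans by blast
qed

text \<open>With a sixth vertex, 0, 2 and 4 form a triangle in the complement. The hole runs through
  2, 4, 0 and exchanges \<open>p\<close> and \<open>s\<close>; on the 5-cycle the middle move would
  clash on the edge between 4 and 0.\<close>

lemma pent_extension_swap:
  assumes a: "all4 p q r s" and x: "list_colouring (pent p q r s @ [x]) \<in> SC 6 K"
  shows "reach 6 K (list_colouring (pent p q r s @ [x])) (list_colouring (pent s q r p @ [x]))"
proof -
  have d: "p \<noteq> q" "p \<noteq> r" "p \<noteq> s" "q \<noteq> r" "q \<noteq> s" "r \<noteq> s"
    using a by (auto simp: all4_def)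
  have x: "{p, q, r, s, x} = {1..K}" "x \<noteq> p" "x \<noteq> s"
    using x by (auto simp: list_colouring_in_SC pent_def insert_commute)
  have in_SC: "list_colouring xs \<in> SC 6 K"
    if "set xs = {p, q, r, s, x}" "length xs = 6" "successively (\<noteq>) xs" "last xs \<noteq> hd xs" for xs
    using that x(1) by (simp add: list_colouring_in_SC)
  have i: "list_colouring [p, q, p, r, s, x] \<in> SC 6 K" "list_colouring [p, q, s, r, s, x] \<in> SC 6 K"
    "list_colouring [p, q, s, r, p, x] \<in> SC 6 K" "list_colouring [s, q, s, r, p, x] \<in> SC 6 K"
    by (rule in_SC; use d x(2,3) in \<open>simp add: insert_commute\<close>)+
  have "reach 6 K (list_colouring [p, q, p, r, s, x]) (list_colouring [p, q, s, r, s, x])"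
    using list_colouring_recol[OF i(1), of 2 s] i(2) by simp
  moreover have "reach 6 K (list_colouring [p, q, s, r, s, x]) (list_colouring [p, q, s, r, p, x])"
    using list_colouring_recol[OF i(2), of 4 p] i(3) by simp
  moreover have "reach 6 K (list_colouring [p, q, s, r, p, x]) (list_colouring [s, q, s, r, p, x])"
    using list_colouring_recol[OF i(3), of 0 s] i(4) by simp
  ultimately show ?thesis unfolding pent_def append.simps by (meson rtranclp_trans)
qed

lemma exists_extension:
  assumes n: "n \<ge> 3" and k: "k \<ge> 4" and K: "K = k \<or> K = Suc k" and f: "f \<in> SC n k"
  obtains z where "f(n := z) \<in> SC (Suc n) K"
proof (cases "K = k")
  case True
  obtain z where "z \<in> {1..k}" "z \<noteq> f 0" "z \<noteq> f (n - 1)"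
    using exists_colour_avoiding[OF k, of "f 0" "f (n - 1)" 0] .
  with True that show ?thesis using SC_extend[OF n f] by blast
next
  case False
  with K that show ?thesis using SC_extend_new_colour[OF n f] by blast
qed

lemma pent_in_SC: "all4 p q r s \<Longrightarrow> list_colouring (pent p q r s) \<in> SC 5 4"
  by (rule list_colouring_in_SC_5) (auto simp: all4_def pent_def)

text \<open>The colourings \<open>f\<close> and \<open>g\<close> may have different cyclic orders
  and so be unreachable from each other on the 5-cycle. Both extensions are therefore linked to one
  of \<open>pent 1 2 3 4\<close>.\<close>

lemma reach_lift_5:
  assumes K: "K = 4 \<or> K = 5" and fg: "f \<in> SC 5 4" "g \<in> SC 5 4"
    and xy: "f(5 := x) \<in> SC 6 K" "g(5 := y) \<in> SC 6 K"
  shows "reach 6 K (f(5 := x)) (g(5 := y))"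
proof -
  have lift: "reach 6 K (f(5 := x)) (g(5 := y))"
    if "reach 5 4 f g" "f \<in> SC 5 4" "f(5 := x) \<in> SC 6 K" "g(5 := y) \<in> SC 6 K" for f g x y
    using reach_lift[of 5 4 K f g x y] that K by simp
  have ext: "\<exists>z. f(5 := z) \<in> SC 6 K" if "f \<in> SC 5 4" for f
    using exists_extension[of 5 4 K f] that K by auto
  have append: "list_colouring (pent p q r s @ [x]) = (list_colouring (pent p q r s))(5 := x)"
    for p q r s x
  proof -
    have "length (pent p q r s) = 5" by (simp add: pent_def)
    then show ?thesis using list_colouring_append[of "pent p q r s" x] by (simp only:)
  qed
  \<comment> \<open>Quantifying over all extensions makes \<open>R\<close> transitive, since by
    \<open>ext\<close> the middle colouring has one.\<close>
  define R where "R xs ys \<longleftrightarrow> list_colouring xs \<in> SC 5 4 \<and> list_colouring ys \<in> SC 5 4 \<and>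
    (\<forall>x y. (list_colouring xs)(5 := x) \<in> SC 6 K \<longrightarrow> (list_colouring ys)(5 := y) \<in> SC 6 K \<longrightarrow>
      reach 6 K ((list_colouring xs)(5 := x)) ((list_colouring ys)(5 := y)))" for xs ys
  have R: "R (pent p q r s) (pent 1 2 3 4)" if "all4 p q r s" for p q r s
  proof (rule four_permutations[OF _ _ _ that])
    fix xs ys zs assume "R xs ys" "R ys zs"
    then show "R xs zs" using ext unfolding R_def by (meson rtranclp_trans)
  next
    fix p q r s assume a: "all4 p q r s"
    then have "all4 s r p q" by (auto simp: all4_def)
    then show "R (pent p q r s) (pent s r p q)"
      using lift[OF pent_rotate[OF a]] pent_in_SC a unfolding R_def by blast
  next
    fix p q r s assume a: "all4 p q r s"
    then have a': "all4 s q r p" by (auto simp: all4_def)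
    have "reach 6 K ((list_colouring (pent p q r s))(5 := x)) ((list_colouring (pent s q r p))(5 := y))"
      if x: "(list_colouring (pent p q r s))(5 := x) \<in> SC 6 K"
        and y: "(list_colouring (pent s q r p))(5 := y) \<in> SC 6 K" for x y
    proof -
      have 1: "reach 6 K ((list_colouring (pent p q r s))(5 := x)) ((list_colouring (pent s q r p))(5 := x))"
        using pent_extension_swap[OF a] x unfolding append .
      have "reach 6 K ((list_colouring (pent s q r p))(5 := x)) ((list_colouring (pent s q r p))(5 := y))"
        using recol_fun_upd[OF reach_SC[OF 1 x] y] by simp
      with 1 show ?thesis by (rule rtranclp_trans)
    qed
    then show "R (pent p q r s) (pent s q r p)" using pent_in_SC a a' unfolding R_def by blast
  qed
  have "{1, 2, 3, 4} = {1..4 :: nat}" by auto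
  then obtain z where z: "(list_colouring (pent 1 2 3 4))(5 := z) \<in> SC 6 K"
    using ext pent_in_SC all4I by meson
  have std: "reach 6 K (f(5 := x)) ((list_colouring (pent 1 2 3 4))(5 := z))"
    if f: "f \<in> SC 5 4" and x: "f(5 := x) \<in> SC 6 K" for f x
  proof -
    obtain p q r s where a: "all4 p q r s" and fp: "reach 5 4 f (list_colouring (pent p q r s))"
      using reach_pent[OF f] .
    obtain w where w: "(list_colouring (pent p q r s))(5 := w) \<in> SC 6 K"
      using ext pent_in_SC[OF a] by blast
    have "reach 6 K ((list_colouring (pent p q r s))(5 := w)) ((list_colouring (pent 1 2 3 4))(5 := z))"
      using R[OF a] w z unfolding R_def by blast
    with lift[OF fp f x w] show ?thesis by (rule rtranclp_trans)
  qed
  show ?thesis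
    using std[OF fg(1) xy(1)] reach_sym[OF std[OF fg(2) xy(2)]] by (rule rtranclp_trans)
qed

section \<open>Connectedness\<close>

lemma reach_all:
  assumes "n \<ge> 6" "4 \<le> k" "k < n" "c \<in> SC n k" "d \<in> SC n k"
  shows "reach n k c d"
  using assms
proof (induction n arbitrary: k c d)
  case (Suc n)
  then have n: "n \<ge> 5" by simp
  \<comment> \<open>The induction hypothesis starts at six vertices; the step from five uses
    \<open>reach_lift_5\<close> instead.\<close>
  have IH: "reach n l f g" if "n \<noteq> 5" "4 \<le> l" "l < n" "f \<in> SC n l" "g \<in> SC n l" for l f g
    using Suc.IH that n by simp
  \<comment> \<open>The cycle has \<open>Suc n\<close> vertices here. A colour is dropped only when
    there are \<open>n\<close> of them, which keeps \<open>l < n\<close>.\<close>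
  define l where "l = (if k = n then n - 1 else k)"
  have l: "4 \<le> l" "l < n" "k = l \<or> k = Suc l" using Suc.prems n by (auto simp: l_def)
  show ?case
  proof (rule reach_all_Suc[where k = l])
    fix f g x y
    assume fg: "f \<in> SC n l" "g \<in> SC n l" and xy: "f(n := x) \<in> SC (Suc n) k" "g(n := y) \<in> SC (Suc n) k"
    show "reach (Suc n) k (f(n := x)) (g(n := y))"
    proof (cases "n = 5")
      case True
      with l have "l = 4" by simp
      with True show ?thesis using reach_lift_5[of k f g x y] fg xy l(3) by simp
    next
      case False
      then show ?thesis using reach_lift[of n l k f g x y] IH[OF False l(1,2) fg] fg xy l n by simp
    qed
  next
    fix c assume c: "c \<in> SC (Suc n) k"
    show "\<exists>d. reach (Suc n) k c d \<and> restrict d {..<n} \<in> SC n l"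
    proof (cases "k = n")
      case True
      then show ?thesis using reach_restrictable_new_colour[OF n] c by (auto simp: l_def)
    next
      case False
      then show ?thesis using reach_restrictable[OF n _ _ c] Suc.prems by (auto simp: l_def)
    qed
  qed (use n Suc.prems in auto)
qed simp

text \<open>The same descent as in \<open>reach_all\<close>, now extending a colouring of the
  shorter cycle and starting from the 5-cycle.\<close>

lemma SC_nonempty:
  assumes "4 \<le> k" "k < n"
  shows "SC n k \<noteq> {}"
  using assms
proof (induction n arbitrary: k)
  case (Suc n)
  show ?case
  proof (cases "n = 4")
    case True
    have "{1, 2, 3, 4} = {1..4 :: nat}" by auto
    then have "list_colouring (pent 1 2 3 4) \<in> SC 5 4" by (intro pent_in_SC all4I)
    moreover have "k = 4" using Suc.prems True by simp
    ultimately show ?thesis using True by auto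
  next
    case False
    define l where "l = (if k = n then n - 1 else k)"
    have l: "4 \<le> l" "l < n" "k = l \<or> k = Suc l" using Suc.prems False by (auto simp: l_def)
    then obtain f where f: "f \<in> SC n l" using Suc.IH by blast
    have "n \<ge> 3" using l by simp
    then show ?thesis using exists_extension[OF _ l(1,3) f] by blast
  qed
qed simp

theorem theorem4p5:
  fixes n k :: nat
  assumes "n \<ge> 3"
    and "k > 0"
    and "k \<ge> chromatic_number (cycle_graph n)"
    and "n \<ge> k + 1"
  shows "Digraph_Component.connected (with_proj (strong_colour_graph (cycle_graph n) k))
         \<longleftrightarrow> k \<ge> 4 \<and> n \<ge> 6 \<and> n \<ge> k + 1"
proof (cases "k \<ge> 4 \<and> n \<ge> 6")
  case True
  then show ?thesis using assms SC_nonempty[of k n] reach_all[of n k]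
    by (auto simp: connected_iff_reach)
next
  case False
  then have "k \<le> 3 \<or> n \<le> 5" by linarith
  with False show ?thesis using not_connected_small[OF assms(1,4)] by blast
qed

end
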